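(* There exist absolute constants $c_1,c_2>0$ such that the following holds. Let $S\subset\mathbb{R}^N$ be a semi-algebraic set contained in $V(\mathbb{R})$, where $V\subset\mathbb{C}^N$ is a real algebraic set which is a union of non-singular real algebraic varieties. Then the height of any algebraic computation tree testing membership in $S$ is at least \[ \frac{1}{1+\log\deg V}\big(c_1\log b_0(S) - c_2\dim V\big). \]
   Context: An algebraic computation tree with input variables $X_1,\ldots,X_N$ is a rooted tree with: computation vertices (outdegree 1), each with a variable $Y_v$ and an instruction $Y_v = a * b$, $*\in\{+,-,\times\}$, where $a,b$ are real constants, input variables, or variables of predecessor vertices; branching vertices (outdegree 3, edges labelled $0,1,-1$), to which $Y_v$ is assigned a real constant, input variable, or predecessor variable, the edges corresponding to $Y_v=0$, $Y_v>0$, $Y_v<0$; and leaves labelled YES or NO. On input $x\in\mathbb{R}^N$ one evaluates along the path from the root, following branches according to signs; $x$ is accepted if the path ends in a YES leaf. The tree tests membership in $S$ if the set of accepted inputs is exactly $S$. The height is the length of the longest root-to-leaf path. $b_0(S)$ is the number of connected components of $S$. $\deg V$, $\dim V$ are the degree and dimension of $V$ as a complex algebraic set. *)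

theory Defs
  imports "HOL-Analysis.Analysis"
begin

text \<open>Points of R^N (resp. C^N) are functions nat => real (complex) vanishing
outside the index set {0..<N}; coordinate i < N corresponds to X_(i+1).\<close>

definition RN :: "nat \<Rightarrow> (nat \<Rightarrow> real) set" where
  "RN N = {x. \<forall>i\<ge>N. x i = 0}"

definition CN :: "nat \<Rightarrow> (nat \<Rightarrow> complex) set" where
  "CN N = {z. \<forall>i\<ge>N. z i = 0}"

datatype mpoly = Cst complex | PVar nat | PAdd mpoly mpoly | PMul mpoly mpoly

fun peval :: "mpoly \<Rightarrow> (nat \<Rightarrow> complex) \<Rightarrow> complex" where
  "peval (Cst c) z = c"
| "peval (PVar i) z = z i"
| "peval (PAdd p q) z = peval p z + peval q z"
| "peval (PMul p q) z = peval p z * peval q z"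

fun pvars_in :: "nat \<Rightarrow> mpoly \<Rightarrow> bool" where
  "pvars_in N (Cst c) = True"
| "pvars_in N (PVar i) = (i < N)"
| "pvars_in N (PAdd p q) = (pvars_in N p \<and> pvars_in N q)"
| "pvars_in N (PMul p q) = (pvars_in N p \<and> pvars_in N q)"

fun preal :: "mpoly \<Rightarrow> bool" where
  "preal (Cst c) = (c \<in> \<real>)"
| "preal (PVar i) = True"
| "preal (PAdd p q) = (preal p \<and> preal q)"
| "preal (PMul p q) = (preal p \<and> preal q)"

definition reval :: "mpoly \<Rightarrow> (nat \<Rightarrow> real) \<Rightarrow> real" where
  "reval p x = Re (peval p (\<lambda>i. complex_of_real (x i)))"

fun pderiv_var :: "nat \<Rightarrow> mpoly \<Rightarrow> mpoly" where
  "pderiv_var i (Cst c) = Cst 0"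
| "pderiv_var i (PVar j) = (if i = j then Cst 1 else Cst 0)"
| "pderiv_var i (PAdd p q) = PAdd (pderiv_var i p) (pderiv_var i q)"
| "pderiv_var i (PMul p q) = PAdd (PMul (pderiv_var i p) q) (PMul p (pderiv_var i q))"

definition zero_set :: "nat \<Rightarrow> mpoly set \<Rightarrow> (nat \<Rightarrow> complex) set" where
  "zero_set N F = {z \<in> CN N. \<forall>p\<in>F. peval p z = 0}"

definition alg_set :: "nat \<Rightarrow> (nat \<Rightarrow> complex) set \<Rightarrow> bool" where
  "alg_set N V \<longleftrightarrow> (\<exists>F. finite F \<and> (\<forall>p\<in>F. pvars_in N p) \<and> V = zero_set N F)"

definition real_alg_set :: "nat \<Rightarrow> (nat \<Rightarrow> complex) set \<Rightarrow> bool" where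
  "real_alg_set N V \<longleftrightarrow>
     (\<exists>F. finite F \<and> (\<forall>p\<in>F. pvars_in N p \<and> preal p) \<and> V = zero_set N F)"

definition irreducible_alg :: "nat \<Rightarrow> (nat \<Rightarrow> complex) set \<Rightarrow> bool" where
  "irreducible_alg N W \<longleftrightarrow> alg_set N W \<and> W \<noteq> {} \<and>
     (\<forall>A B. alg_set N A \<and> alg_set N B \<and> W = A \<union> B \<longrightarrow> W = A \<or> W = B)"

definition alg_dim :: "nat \<Rightarrow> (nat \<Rightarrow> complex) set \<Rightarrow> nat" where
  "alg_dim N V = Sup {d. \<exists>Ws :: nat \<Rightarrow> (nat \<Rightarrow> complex) set.
       (\<forall>j\<le>d. irreducible_alg N (Ws j)) \<and> (\<forall>j<d. Ws j \<subset> Ws (Suc j)) \<and> Ws d \<subseteq> V}"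

definition irr_components :: "nat \<Rightarrow> (nat \<Rightarrow> complex) set \<Rightarrow> (nat \<Rightarrow> complex) set set" where
  "irr_components N V = {W. irreducible_alg N W \<and> W \<subseteq> V \<and>
       (\<forall>W'. irreducible_alg N W' \<and> W \<subseteq> W' \<and> W' \<subseteq> V \<longrightarrow> W' = W)}"

definition lin_indep_vecs :: "nat \<Rightarrow> nat \<Rightarrow> (nat \<Rightarrow> nat \<Rightarrow> complex) \<Rightarrow> bool" where
  "lin_indep_vecs N m g \<longleftrightarrow>
     (\<forall>t::nat \<Rightarrow> complex. (\<forall>i<N. (\<Sum>j<m. t j * g j i) = 0) \<longrightarrow> (\<forall>j<m. t j = 0))"

definition affine_subspace_dim :: "nat \<Rightarrow> nat \<Rightarrow> (nat \<Rightarrow> complex) set \<Rightarrow> bool" where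
  "affine_subspace_dim N k L \<longleftrightarrow> (\<exists>q v. q \<in> CN N \<and> (\<forall>j<k. v j \<in> CN N) \<and>
      lin_indep_vecs N k v \<and>
      L = {(\<lambda>i. q i + (\<Sum>j<k. t j * v j i)) | t. True})"

text \<open>Degree of an irreducible algebraic set W (Heintz): maximal number of points
 of W \<inter> L, L an affine subspace of dimension N - dim W, W \<inter> L finite.\<close>
definition deg_irred :: "nat \<Rightarrow> (nat \<Rightarrow> complex) set \<Rightarrow> nat" where
  "deg_irred N W = Sup {card (W \<inter> L) | L.
       affine_subspace_dim N (N - alg_dim N W) L \<and> finite (W \<inter> L)}"

definition alg_deg :: "nat \<Rightarrow> (nat \<Rightarrow> complex) set \<Rightarrow> nat" where
  "alg_deg N V = (\<Sum>W\<in>irr_components N V. deg_irred N W)"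

definition vanishing_ideal :: "nat \<Rightarrow> (nat \<Rightarrow> complex) set \<Rightarrow> mpoly set" where
  "vanishing_ideal N X = {p. pvars_in N p \<and> (\<forall>z\<in>X. peval p z = 0)}"

definition grad_rank_at_least :: "nat \<Rightarrow> (nat \<Rightarrow> complex) set \<Rightarrow> (nat \<Rightarrow> complex) \<Rightarrow> nat \<Rightarrow> bool" where
  "grad_rank_at_least N X z m \<longleftrightarrow> (\<exists>ps :: nat \<Rightarrow> mpoly.
      (\<forall>j<m. ps j \<in> vanishing_ideal N X) \<and>
      lin_indep_vecs N m (\<lambda>j i. peval (pderiv_var i (ps j)) z))"

definition nonsingular_point :: "nat \<Rightarrow> (nat \<Rightarrow> complex) set \<Rightarrow> (nat \<Rightarrow> complex) \<Rightarrow> bool" where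
  "nonsingular_point N X z \<longleftrightarrow>
     grad_rank_at_least N X z (N - alg_dim N X) \<and>
     \<not> grad_rank_at_least N X z (N - alg_dim N X + 1)"

definition nonsingular_real_variety :: "nat \<Rightarrow> (nat \<Rightarrow> complex) set \<Rightarrow> bool" where
  "nonsingular_real_variety N X \<longleftrightarrow> real_alg_set N X \<and> irreducible_alg N X \<and>
     (\<forall>z\<in>X. nonsingular_point N X z)"

definition union_of_nonsingular_real_varieties :: "nat \<Rightarrow> (nat \<Rightarrow> complex) set \<Rightarrow> bool" where
  "union_of_nonsingular_real_varieties N V \<longleftrightarrow>
     (\<exists>\<X>. finite \<X> \<and> (\<forall>X\<in>\<X>. nonsingular_real_variety N X) \<and> V = \<Union>\<X>)"

definition real_points :: "nat \<Rightarrow> (nat \<Rightarrow> complex) set \<Rightarrow> (nat \<Rightarrow> real) set" where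
  "real_points N V = {x \<in> RN N. (\<lambda>i. complex_of_real (x i)) \<in> V}"

inductive semialg :: "nat \<Rightarrow> (nat \<Rightarrow> real) set \<Rightarrow> bool" for N where
  eq: "pvars_in N p \<Longrightarrow> preal p \<Longrightarrow> semialg N {x \<in> RN N. reval p x = 0}"
| gt: "pvars_in N p \<Longrightarrow> preal p \<Longrightarrow> semialg N {x \<in> RN N. reval p x > 0}"
| un: "semialg N A \<Longrightarrow> semialg N B \<Longrightarrow> semialg N (A \<union> B)"
| int: "semialg N A \<Longrightarrow> semialg N B \<Longrightarrow> semialg N (A \<inter> B)"
| compl: "semialg N A \<Longrightarrow> semialg N (RN N - A)"

definition b0 :: "(nat \<Rightarrow> real) set \<Rightarrow> nat" where
  "b0 S = card {connected_component_set S x | x. x \<in> S}"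

text \<open>Operands: real constant, input variable X_(i+1), or the variable Y_v of the
 predecessor vertex at depth k on the current path (root has depth 0).\<close>
datatype operand = OConst real | OInput nat | OPred nat
datatype arith_op = OpPlus | OpMinus | OpTimes

datatype act =
    Leaf bool
  | Comp arith_op operand operand act
  | Branch operand act act act  (* children for Y_v = 0, Y_v > 0, Y_v < 0 *)

fun operand_val :: "operand \<Rightarrow> (nat \<Rightarrow> real) \<Rightarrow> real list \<Rightarrow> real" where
  "operand_val (OConst c) x ys = c"
| "operand_val (OInput i) x ys = x i"
| "operand_val (OPred k) x ys = ys ! k"

fun apply_op :: "arith_op \<Rightarrow> real \<Rightarrow> real \<Rightarrow> real" where
  "apply_op OpPlus a b = a + b"
| "apply_op OpMinus a b = a - b"
| "apply_op OpTimes a b = a * b"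

fun act_run :: "act \<Rightarrow> (nat \<Rightarrow> real) \<Rightarrow> real list \<Rightarrow> bool" where
  "act_run (Leaf b) x ys = b"
| "act_run (Comp f a b t) x ys =
     act_run t x (ys @ [apply_op f (operand_val a x ys) (operand_val b x ys)])"
| "act_run (Branch a t0 tp tn) x ys =
     (let y = operand_val a x ys in
      if y = 0 then act_run t0 x (ys @ [y])
      else if y > 0 then act_run tp x (ys @ [y])
      else act_run tn x (ys @ [y]))"

fun operand_wf :: "nat \<Rightarrow> nat \<Rightarrow> operand \<Rightarrow> bool" where
  "operand_wf N d (OConst c) = True"
| "operand_wf N d (OInput i) = (i < N)"
| "operand_wf N d (OPred k) = (k < d)"

fun act_wf :: "nat \<Rightarrow> nat \<Rightarrow> act \<Rightarrow> bool" where
  "act_wf N d (Leaf b) = True"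
| "act_wf N d (Comp f a b t) = (operand_wf N d a \<and> operand_wf N d b \<and> act_wf N (Suc d) t)"
| "act_wf N d (Branch a t0 tp tn) =
     (operand_wf N d a \<and> act_wf N (Suc d) t0 \<and> act_wf N (Suc d) tp \<and> act_wf N (Suc d) tn)"

fun act_height :: "act \<Rightarrow> nat" where
  "act_height (Leaf b) = 0"
| "act_height (Comp f a b t) = Suc (act_height t)"
| "act_height (Branch a t0 tp tn) = Suc (max (act_height t0) (max (act_height tp) (act_height tn)))"

definition tests_membership :: "nat \<Rightarrow> act \<Rightarrow> (nat \<Rightarrow> real) set \<Rightarrow> bool" where
  "tests_membership N t S \<longleftrightarrow> act_wf N 0 t \<and> S \<subseteq> RN N \<and>
     (\<forall>x\<in>RN N. act_run t x [] \<longleftrightarrow> x \<in> S)"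

end

theory Submission
  imports Defs "HOL-Library.Function_Algebras"
begin

text \<open>A tree of height \<open>h\<close> only recognises sets \<open>S\<close> with \<open>b\<^sub>0(S) \<le> 1029^h\<close>. Indeed, a root-to-leaf path reads at most \<open>2h\<close> input coordinates, so
  the inputs following it form a cylinder over a set which, with \<open>h\<close> auxiliary variables, is a
  projection of the zero set of a nonnegative polynomial of degree 6 in at most \<open>3h\<close> variables.
  For such a zero set an elementary Oleinik-Petrovsky-Milnor-Thom bound suffices: perturbing by
  \<open>\<Sum> x\<^sub>i^(d+2)\<close> makes the critical point equations a system without solutions at infinity, so that
  its solutions are counted by reduced monomials, with no need for transversality or Bezout.\<close>

text \<open>The theorem is reached through \<open>h >= ln (b0 S) / ln 1029\<close>: subtracting a
  multiple of the dimension and weighting \<open>h\<close> by \<open>1 + ln (deg V) >= 1\<close>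
  both preserve this inequality. What has to be overcome is the ambient dimension: a Milnor-Thom
  bound in R^N carries \<open>N\<close> in its exponent, whereas the base obtained here must be an
  absolute constant. Composing instructions along a path would let the degree double at each
  multiplication. Hence every computed value receives a coordinate of its own, so that all stored
  values have degree at most 1 and each vertex contributes one equation of bounded degree. The
  largest degree comes from a strict sign, \<open>(v s^2 - 1)^2\<close> with \<open>v\<close> of
  degree 1. In \<open>1029 = 3 * 7^3\<close> the 3 counts the outcomes of a branching, 7 counts the
  exponents 0 to 6 of one variable in a reduced monomial, and the cube reflects at most three new
  variables per vertex: two operands and one auxiliary coordinate.\<close>

section \<open>Real polynomial functions of bounded degree\<close>

text \<open>Functions rather than syntax, because only values matter; \<open>d\<close> is an upper
  bound for the total degree. Degree grows by one variable at a time, which matches the reduction of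
  monomials below.\<close>

inductive poly_fun :: "nat set \<Rightarrow> nat \<Rightarrow> ((nat \<Rightarrow> real) \<Rightarrow> real) \<Rightarrow> bool" for I where
  const: "poly_fun I d (\<lambda>_. c)"
| var_times: "i \<in> I \<Longrightarrow> poly_fun I d f \<Longrightarrow> poly_fun I (Suc d) (\<lambda>x. x i * f x)"
| add: "poly_fun I d f \<Longrightarrow> poly_fun I d g \<Longrightarrow> poly_fun I d (\<lambda>x. f x + g x)"

lemma poly_fun_mono:
  assumes "poly_fun I d f" "I \<subseteq> J" "d \<le> e"
  shows "poly_fun J e f"
  using assms(1,3)
proof (induction arbitrary: e)
  case (var_times i d f)
  then obtain e' where e': "e = Suc e'" "d \<le> e'"
    by (cases e) auto
  with var_times assms(2) show ?case
    by (auto intro!: poly_fun.var_times)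
qed (auto intro: poly_fun.intros)

lemma poly_fun_var: "i \<in> I \<Longrightarrow> poly_fun I (Suc 0) (\<lambda>x. x i)"
  using poly_fun.var_times[OF _ poly_fun.const[of I 0 1]] by simp

lemma poly_fun_cmult: "poly_fun I d f \<Longrightarrow> poly_fun I d (\<lambda>x. c * f x)"
proof (induction rule: poly_fun.induct)
  case (var_times i d f)
  then show ?case
    using poly_fun.var_times[of i I d "\<lambda>x. c * f x"] by (simp add: mult.left_commute)
next
  case (add d f g)
  then show ?case
    using poly_fun.add[OF add.IH] by (simp add: distrib_left)
qed (auto intro: poly_fun.intros)

lemma poly_fun_diff:
  "poly_fun I d f \<Longrightarrow> poly_fun I d g \<Longrightarrow> poly_fun I d (\<lambda>x. f x - g x)"
  using poly_fun.add[OF _ poly_fun_cmult[of I d g "-1"]] by simp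

lemma poly_fun_mult:
  assumes "poly_fun I d f" "poly_fun I e g"
  shows "poly_fun I (d + e) (\<lambda>x. f x * g x)"
  using assms(1)
proof (induction rule: poly_fun.induct)
  case (const d c)
  then show ?case
    using poly_fun_mono[OF poly_fun_cmult[OF assms(2)]] by auto
next
  case (var_times i d f)
  then show ?case
    using poly_fun.var_times[of i I "d + e" "\<lambda>x. f x * g x"] by (simp add: mult.assoc)
next
  case (add d f h)
  then show ?case
    using poly_fun.add[OF add.IH] by (simp add: distrib_right)
qed

lemma poly_fun_prod:
  assumes "finite A" "\<And>a. a \<in> A \<Longrightarrow> poly_fun I (k a) (f a)"
  shows "poly_fun I (\<Sum>a\<in>A. k a) (\<lambda>x. \<Prod>a\<in>A. f a x)"
  using assms by (induction A) (auto intro: poly_fun.const poly_fun_mult)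

lemma poly_fun_cong:
  assumes "poly_fun I d f" "\<And>i. i \<in> I \<Longrightarrow> x i = y i"
  shows "f x = f y"
  using assms by (induction rule: poly_fun.induct) auto

lemma continuous_on_poly_fun [continuous_intros]:
  "poly_fun I d f \<Longrightarrow> continuous_on A f"
  by (induction rule: poly_fun.induct)
    (auto intro!: continuous_intros intro: continuous_on_subset[OF continuous_on_product_coordinates])

text \<open>The bound stays at \<open>d\<close> instead of \<open>d - 1\<close>: it only has to lie
  below the degree \<open>d + 1\<close> of the derivative of \<open>x_i^(d+2)\<close>.\<close>

lemma poly_fun_partial_derivative:
  assumes "poly_fun I d f"
  shows "\<exists>f'. poly_fun I d f' \<and>
    (\<forall>x. ((\<lambda>s. f (x(i := s))) has_field_derivative f' x) (at (x i)))"
  using assms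
proof (induction rule: poly_fun.induct)
  case (const d c)
  then show ?case by (intro exI[of _ "\<lambda>_. 0"]) (auto intro: poly_fun.const)
next
  case (var_times j d f)
  then obtain f' where f': "poly_fun I d f'"
    "\<And>x. ((\<lambda>s. f (x(i := s))) has_field_derivative f' x) (at (x i))"
    by blast
  define g where "g = (\<lambda>x. (if i = j then 1 else 0) * f x + x j * f' x)"
  have "poly_fun I (Suc d) g"
    unfolding g_def
    by (intro poly_fun.add poly_fun_cmult poly_fun.var_times var_times f')
      (rule poly_fun_mono[OF var_times(2)], auto)
  moreover have "((\<lambda>s. (x(i := s)) j * f (x(i := s))) has_field_derivative g x) (at (x i))" for x
  proof -
    have "((\<lambda>s. (x(i := s)) j) has_field_derivative (if i = j then 1 else 0)) (at (x i))"
      by auto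
    from DERIV_mult[OF this f'(2)[of x]] show ?thesis
      unfolding g_def by (simp add: mult.commute add.commute)
  qed
  ultimately show ?case by blast
next
  case (add d f g)
  then obtain f' g' where
    "poly_fun I d f'" "\<And>x. ((\<lambda>s. f (x(i := s))) has_field_derivative f' x) (at (x i))"
    "poly_fun I d g'" "\<And>x. ((\<lambda>s. g (x(i := s))) has_field_derivative g' x) (at (x i))"
    by blast
  then show ?case
    by (intro exI[of _ "\<lambda>x. f' x + g' x"] conjI allI poly_fun.add DERIV_add)
qed

section \<open>Counting points by reduced monomials\<close>

interpretation fun_space: vector_space "\<lambda>c (f :: 'a \<Rightarrow> real) x. c * f x"
  by unfold_locales (auto simp: fun_eq_iff algebra_simps)

text \<open>Modulo the relations below every polynomial function on \<open>Q\<close> reduces to monomials with all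
  exponents at most \<open>m\<close>, while the indicator functions of the points of \<open>Q\<close> are polynomial and
  linearly independent.\<close>

lemma card_le_if_powers_reduce:
  fixes Q :: "(nat \<Rightarrow> real) set"
  assumes I: "finite I" and Q: "finite Q" and supp: "\<And>x i. x \<in> Q \<Longrightarrow> i \<notin> I \<Longrightarrow> x i = 0"
    and h: "\<And>i. i \<in> I \<Longrightarrow> poly_fun I m (h i)"
    and red: "\<And>x i. x \<in> Q \<Longrightarrow> i \<in> I \<Longrightarrow> x i ^ Suc m = h i x"
  shows "card Q \<le> Suc m ^ card I"
proof -
  \<comment> \<open>Cutting functions off outside \<open>Q\<close> turns the relations, which hold
    only on \<open>Q\<close>, into identities of functions.\<close>
  define res where "res = (\<lambda>(f :: (nat \<Rightarrow> real) \<Rightarrow> real) x. if x \<in> Q then f x else 0)"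
  define mon where "mon = (\<lambda>e. res (\<lambda>x. \<Prod>i\<in>I. x i ^ e i))"
  define E where "E = (\<lambda>d. {e \<in> I \<rightarrow>\<^sub>E {..m}. sum e I \<le> d})"
  have finE: "finite (I \<rightarrow>\<^sub>E {..m})"
    using I by (intro finite_PiE) auto
  have poly_prod: "poly_fun I (sum e I) (\<lambda>x. \<Prod>i\<in>I. x i ^ e i)" for e
  proof (rule poly_fun_prod[OF I])
    fix i assume "i \<in> I"
    have "poly_fun I (\<Sum>a<e i. Suc 0) (\<lambda>x. \<Prod>a<e i. x i)"
      by (intro poly_fun_prod poly_fun_var \<open>i \<in> I\<close>) auto
    then show "poly_fun I (e i) (\<lambda>x. x i ^ e i)" by simp
  qed
  \<comment> \<open>The outer induction on the degree is essential: rewriting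
    \<open>x_i^(m+1)\<close> to \<open>h i\<close> yields a polynomial that is no subterm of the
    given one, but has smaller degree.\<close>
  have span_E: "res f \<in> fun_space.span (mon ` E d)" if "poly_fun I d f" for f d
    using that
  proof (induction d arbitrary: f rule: less_induct)
    case (less d)
    from less.prems less.IH show ?case
    proof (induction rule: poly_fun.induct)
      case (const d c)
      define e where "e = (\<lambda>i. if i \<in> I then 0 else undefined :: nat)"
      have "e \<in> E d" by (auto simp: E_def e_def PiE_def extensional_def)
      then have "(\<lambda>x. c * mon e x) \<in> fun_space.span (mon ` E d)"
        by (intro fun_space.span_scale fun_space.span_base) auto
      moreover have "(\<lambda>x. c * mon e x) = res (\<lambda>_. c)"
        by (auto simp: mon_def res_def e_def fun_eq_iff)
      ultimately show ?case by simp
    next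
      case (add d f g)
      have "res (\<lambda>x. f x + g x) = res f + res g"
        by (auto simp: res_def fun_eq_iff)
      with add show ?case by (simp only: fun_space.span_add)
    next
      case (var_times i d f)
      note IH = var_times.prems(1)
      have mono: "fun_space.span (mon ` E d) \<subseteq> fun_space.span (mon ` E (Suc d))"
        by (rule fun_space.span_mono) (auto simp: E_def)
      \<comment> \<open>Multiplication by \<open>x i\<close> is linear, so \<open>L\<close> is a
        subspace and it is enough to test the monomials that span.\<close>
      define L where "L = {g. (\<lambda>x. x i * g x) \<in> fun_space.span (mon ` E (Suc d))}"
      have "fun_space.subspace L"
      proof (rule fun_space.subspaceI)
        show "0 \<in> L" using fun_space.span_zero[of "mon ` E (Suc d)"]
          by (simp add: L_def zero_fun_def)
      next
        fix g g' assume "g \<in> L" "g' \<in> L"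
        then have "(\<lambda>x. x i * g x) + (\<lambda>x. x i * g' x) \<in> fun_space.span (mon ` E (Suc d))"
          unfolding L_def by (auto intro: fun_space.span_add)
        then show "g + g' \<in> L" by (simp add: L_def plus_fun_def distrib_left)
      next
        fix c g assume "g \<in> L"
        then have "(\<lambda>x. c * (x i * g x)) \<in> fun_space.span (mon ` E (Suc d))"
          unfolding L_def by (auto intro: fun_space.span_scale)
        then show "(\<lambda>x. c * g x) \<in> L" by (simp add: L_def mult.left_commute)
      qed
      moreover have "mon ` E d \<subseteq> L"
      proof clarify
        fix e assume e: "e \<in> E d"
        have split: "(\<Prod>j\<in>I. x j ^ e j) = x i ^ e i * (\<Prod>j\<in>I - {i}. x j ^ e j)" for x :: "nat \<Rightarrow> real"
          using I var_times.hyps(1) by (simp add: prod.remove)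
        have split_sum: "sum e I = e i + sum e (I - {i})"
          using I var_times.hyps(1) by (simp add: sum.remove)
        show "mon e \<in> L"
        proof (cases "e i = m")
          case False
          have "e(i := Suc (e i)) \<in> E (Suc d)"
            using e False var_times.hyps(1) I split_sum
            by (auto simp: E_def PiE_def extensional_def Pi_def le_less sum.remove)
          moreover have "(\<lambda>x. x i * mon e x) = mon (e(i := Suc (e i)))"
            using var_times.hyps(1) I
            by (auto simp: mon_def res_def fun_eq_iff prod.remove)
          ultimately show ?thesis
            by (auto simp: L_def intro: fun_space.span_base)
        next
          case True
          \<comment> \<open>The factor \<open>x_i^(m+1)\<close> is replaced by \<open>h i\<close>,
            and \<open>e0\<close> is what remains of the exponent. The degree bound falls from
            \<open>Suc d\<close> to \<open>d\<close>, so the outer hypothesis applies.\<close>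
          define e0 where "e0 = e(i := 0)"
          have "poly_fun I (m + sum e0 I) (\<lambda>x. h i x * (\<Prod>j\<in>I. x j ^ e0 j))"
            using var_times.hyps(1) by (intro poly_fun_mult h poly_prod)
          moreover have "m + sum e0 I \<le> d"
            using e True split_sum var_times.hyps(1) I by (auto simp: E_def e0_def sum.remove)
          ultimately have "poly_fun I d (\<lambda>x. h i x * (\<Prod>j\<in>I. x j ^ e0 j))"
            using poly_fun_mono by blast
          then have "res (\<lambda>x. h i x * (\<Prod>j\<in>I. x j ^ e0 j)) \<in> fun_space.span (mon ` E d)"
            by (intro IH) auto
          moreover have "(\<lambda>x. x i * mon e x) = res (\<lambda>x. h i x * (\<Prod>j\<in>I. x j ^ e0 j))"
          proof
            fix x
            have "x i * x i ^ e i = h i x" if "x \<in> Q"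
              using red[OF that var_times.hyps(1)] True by simp
            then show "x i * mon e x = res (\<lambda>x. h i x * (\<Prod>j\<in>I. x j ^ e0 j)) x"
              using var_times.hyps(1) I split[of x]
              by (simp add: mon_def res_def e0_def prod.remove mult.assoc [symmetric])
          qed
          ultimately show ?thesis using mono by (auto simp: L_def)
        qed
      qed
      ultimately have "fun_space.span (mon ` E d) \<subseteq> L"
        by (rule fun_space.span_minimal[rotated])
      moreover have "res f \<in> fun_space.span (mon ` E d)"
        by (rule IH) (auto intro: var_times.hyps)
      ultimately have "(\<lambda>x. x i * res f x) \<in> fun_space.span (mon ` E (Suc d))"
        by (auto simp: L_def)
      moreover have "(\<lambda>x. x i * res f x) = res (\<lambda>x. x i * f x)"
        by (auto simp: res_def fun_eq_iff)
      ultimately show ?case by simp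
    qed
  qed
  define ind where "ind = (\<lambda>(q :: nat \<Rightarrow> real) x. if x = q then 1 else 0 :: real)"
  have inj: "inj_on ind Q"
  proof (rule inj_onI)
    fix q r assume "ind q = ind r"
    from fun_cong[OF this, of q] show "q = r" by (simp add: ind_def split: if_splits)
  qed
  have "fun_space.independent (ind ` Q)"
  proof
    assume "fun_space.dependent (ind ` Q)"
    then obtain f v where v: "v \<in> ind ` Q" "f v \<noteq> 0"
      and 0: "(\<Sum>v\<in>ind ` Q. (\<lambda>x. f v * v x)) = 0"
      unfolding fun_space.dependent_finite[OF finite_imageI[OF Q]] by (elim exE conjE bexE)
    from v(1) obtain q where q: "q \<in> Q" "v = ind q" by blast
    have eval: "(\<Sum>r\<in>R. (\<lambda>x. a r * b r x)) y = (\<Sum>r\<in>R. a r * b r y)"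
      for R and a :: "(nat \<Rightarrow> real) \<Rightarrow> real" and b :: "(nat \<Rightarrow> real) \<Rightarrow> (nat \<Rightarrow> real) \<Rightarrow> real" and y
      by (induction R rule: infinite_finite_induct) simp_all
    have "(\<Sum>v\<in>ind ` Q. (\<lambda>x. f v * v x)) = (\<Sum>r\<in>Q. (\<lambda>x. f (ind r) * ind r x))"
      using inj by (simp add: sum.reindex)
    then have "0 = (\<Sum>r\<in>Q. (\<lambda>x. f (ind r) * ind r x)) q"
      using 0 by simp
    also have "\<dots> = (\<Sum>r\<in>Q. f (ind r) * ind r q)"
      by (rule eval)
    also have "\<dots> = (\<Sum>r\<in>Q. if r = q then f (ind r) else 0)"
      by (intro sum.cong) (auto simp: ind_def)
    also have "\<dots> = f v" using Q q by simp
    finally show False using v(2) by simp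
  qed
  moreover have "ind ` Q \<subseteq> fun_space.span (mon ` (I \<rightarrow>\<^sub>E {..m}))"
  proof clarify
    fix q assume q: "q \<in> Q"
    have "\<exists>i\<in>I. q i \<noteq> r i" if "r \<in> Q - {q}" for r
    proof (rule ccontr)
      assume "\<not> ?thesis"
      then have "q = r" using supp q that by (metis DiffD1 ext)
      then show False using that by simp
    qed
    then obtain c where c: "\<And>r. r \<in> Q - {q} \<Longrightarrow> c r \<in> I \<and> q (c r) \<noteq> r (c r)"
      by metis
    \<comment> \<open>Lagrange interpolation: each factor is 1 at \<open>q\<close> and vanishes at
      one other point \<open>r\<close>, using a coordinate \<open>c r\<close> in \<open>I\<close>
      that distinguishes them.\<close>
    define f where "f = (\<lambda>x. \<Prod>r\<in>Q - {q}. inverse (q (c r) - r (c r)) * (x (c r) - r (c r)))"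
    have "poly_fun I (\<Sum>r\<in>Q - {q}. Suc 0) f"
      unfolding f_def
      by (intro poly_fun_prod poly_fun_cmult poly_fun_diff poly_fun_var poly_fun.const)
        (use Q c in auto)
    from span_E[OF this] have "res f \<in> fun_space.span (mon ` (I \<rightarrow>\<^sub>E {..m}))"
      by (rule subsetD[OF fun_space.span_mono, rotated]) (auto simp: E_def)
    moreover have "res f = ind q"
    proof
      fix x
      have "f q = 1" unfolding f_def using c by (intro prod.neutral) auto
      moreover have "f x = 0" if "x \<in> Q" "x \<noteq> q"
        unfolding f_def using that Q by (intro prod_zero bexI[of _ x]) auto
      ultimately show "res f x = ind q x" using q by (auto simp: res_def ind_def)
    qed
    ultimately show "ind q \<in> fun_space.span (mon ` (I \<rightarrow>\<^sub>E {..m}))" by simp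
  qed
  ultimately have "card (ind ` Q) \<le> card (mon ` (I \<rightarrow>\<^sub>E {..m}))"
    by (rule fun_space.independent_span_bound[OF finite_imageI[OF finE], THEN conjunct2])
  also have "\<dots> \<le> card (I \<rightarrow>\<^sub>E {..m})"
    by (rule card_image_le[OF finE])
  also have "\<dots> = Suc m ^ card I"
    using I by (simp add: card_PiE)
  finally show ?thesis using card_image[OF inj] by simp
qed

section \<open>Upper bounds on the number of connected components\<close>

text \<open>Testing finite sets of pairwise separated points also rules out infinitely many
  components, which \<open>card\<close> would report as 0. Such test sets are easy to lift along
  maps and to split over unions.\<close>

definition components_le :: "'a::topological_space set \<Rightarrow> nat \<Rightarrow> bool" where
  "components_le S k \<longleftrightarrow> (\<forall>F. finite F \<and> F \<subseteq> S \<and>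
     (\<forall>p\<in>F. \<forall>q\<in>F. connected_component S p q \<longrightarrow> p = q) \<longrightarrow> card F \<le> k)"

lemma components_leI:
  assumes "\<And>F. finite F \<Longrightarrow> F \<subseteq> S \<Longrightarrow>
    (\<And>p q. p \<in> F \<Longrightarrow> q \<in> F \<Longrightarrow> connected_component S p q \<Longrightarrow> p = q) \<Longrightarrow> card F \<le> k"
  shows "components_le S k"
  using assms by (auto simp: components_le_def)

lemma components_leD:
  assumes "components_le S k" "finite F" "F \<subseteq> S"
    "\<And>p q. p \<in> F \<Longrightarrow> q \<in> F \<Longrightarrow> connected_component S p q \<Longrightarrow> p = q"
  shows "card F \<le> k"
  using assms by (auto simp: components_le_def)

lemma components_le_mono: "components_le S k \<Longrightarrow> k \<le> l \<Longrightarrow> components_le S l"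
  unfolding components_le_def by (meson order_trans)

lemma components_le_empty: "components_le {} k"
  by (auto simp: components_le_def)

lemma components_le_image:
  assumes S: "components_le S k" and f: "continuous_on S f"
  shows "components_le (f ` S) k"
proof (rule components_leI)
  fix F assume F: "finite F" "F \<subseteq> f ` S"
    and sep: "\<And>p q. p \<in> F \<Longrightarrow> q \<in> F \<Longrightarrow> connected_component (f ` S) p q \<Longrightarrow> p = q"
  obtain G where G: "G \<subseteq> S" "inj_on f G" "F = f ` G"
    using F(2) by (meson subset_image_inj)
  have "p = q" if pq: "p \<in> G" "q \<in> G" and "connected_component S p q" for p q
  proof -
    obtain T where T: "connected T" "T \<subseteq> S" "p \<in> T" "q \<in> T"
      using \<open>connected_component S p q\<close> by (auto simp: connected_component_def)
    then have "connected (f ` T)" "f ` T \<subseteq> f ` S"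
      using f by (auto intro: connected_continuous_image continuous_on_subset)
    then have "connected_component (f ` S) (f p) (f q)"
      using T by (auto simp: connected_component_def)
    then show ?thesis
      using sep G pq by (metis image_eqI inj_onD)
  qed
  moreover have "finite G" using F G finite_imageD by blast
  ultimately have "card G \<le> k"
    by (intro components_leD[OF S] G)
  then show "card F \<le> k"
    using G by (simp add: card_image)
qed

lemma components_le_Un:
  assumes A: "components_le A k" and B: "components_le B l"
  shows "components_le (A \<union> B) (k + l)"
proof (rule components_leI)
  fix F assume F: "finite F" "F \<subseteq> A \<union> B"
    and sep: "\<And>p q. p \<in> F \<Longrightarrow> q \<in> F \<Longrightarrow> connected_component (A \<union> B) p q \<Longrightarrow> p = q"
  have "card (F \<inter> A) \<le> k"
    by (rule components_leD[OF A]) (use F sep in \<open>auto intro: connected_component_of_subset\<close>)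
  moreover have "card (F \<inter> B) \<le> l"
    by (rule components_leD[OF B]) (use F sep in \<open>auto intro: connected_component_of_subset\<close>)
  moreover have "F = (F \<inter> A) \<union> (F \<inter> B)" using F by blast
  ultimately show "card F \<le> k + l"
    by (metis add_mono card_Un_le order_trans)
qed

text \<open>The map \<open>r\<close> need not be continuous: joining each point to its image inside
  \<open>S\<close> already carries separated points to separated points.\<close>

lemma components_le_deformation:
  assumes R: "components_le R k" and "R \<subseteq> S"
    and r: "\<And>x. x \<in> S \<Longrightarrow> r x \<in> R \<and> connected_component S x (r x)"
  shows "components_le S k"
proof (rule components_leI)
  fix F assume F: "finite F" "F \<subseteq> S"
    and sep: "\<And>p q. p \<in> F \<Longrightarrow> q \<in> F \<Longrightarrow> connected_component S p q \<Longrightarrow> p = q"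
  have conn: "p = q" if "p \<in> F" "q \<in> F" "connected_component S (r p) (r q)" for p q
    using that sep r F
    by (meson connected_component_sym connected_component_trans subsetD)
  have "inj_on r F"
  proof (rule inj_onI)
    fix p q assume "p \<in> F" "q \<in> F" "r p = r q"
    moreover have "r q \<in> S" using \<open>q \<in> F\<close> F r \<open>R \<subseteq> S\<close> by blast
    ultimately show "p = q"
      using conn[of p q] by (simp add: connected_component_refl)
  qed
  moreover have "card (r ` F) \<le> k"
  proof (rule components_leD[OF R])
    fix y z assume "y \<in> r ` F" "z \<in> r ` F" "connected_component R y z"
    then show "y = z"
      using conn connected_component_of_subset[OF _ \<open>R \<subseteq> S\<close>] by blast
  qed (use F r in auto)
  ultimately show "card F \<le> k" by (simp add: card_image)
qed

lemma b0_le: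
  assumes "components_le S k"
  shows "b0 S \<le> k"
proof (rule ccontr)
  define CC where "CC = (\<lambda>x. connected_component_set S x) ` S"
  have CC: "b0 S = card CC" by (auto simp: b0_def CC_def intro: arg_cong[of _ _ card])
  assume "\<not> b0 S \<le> k"
  then obtain D where D: "D \<subseteq> CC" "finite D" "card D = Suc k"
    using CC by (metis Suc_leI not_le obtain_subset_with_card_n)
  obtain F where F: "F \<subseteq> S" "inj_on (connected_component_set S) F" "D = connected_component_set S ` F"
    using D(1) unfolding CC_def by (meson subset_image_inj)
  have "card F \<le> k"
  proof (rule components_leD[OF assms])
    show "finite F" using D F finite_imageD by blast
    fix p q assume "p \<in> F" "q \<in> F" "connected_component S p q"
    then show "p = q" using F by (metis connected_component_eq inj_onD mem_Collect_eq)
  qed (use F in auto)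
  then show False using D F by (simp add: card_image)
qed

text \<open>A component of \<open>K\<close> need not be open in \<open>K\<close>, so components
  cannot serve as the sets \<open>A p\<close>. In a compact Hausdorff space, however, components are
  quasi-components, and two points in different ones are separated by a clopen set.\<close>

lemma compact_clopen_separation:
  fixes K :: "'a::metric_space set"
  assumes K: "compact K" and F: "finite F" "F \<subseteq> K"
    and sep: "\<And>p q. p \<in> F \<Longrightarrow> q \<in> F \<Longrightarrow> connected_component K p q \<Longrightarrow> p = q"
  obtains A where "\<And>p. p \<in> F \<Longrightarrow> p \<in> A p \<and> A p \<subseteq> K \<and> closed (A p) \<and> closed (K - A p)"
    "\<And>p q. p \<in> F \<Longrightarrow> q \<in> F \<Longrightarrow> p \<noteq> q \<Longrightarrow> A p \<inter> A q = {}"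
proof -
  have *: "\<exists>U. p \<in> U \<and> q \<notin> U \<and> U \<subseteq> K \<and> closed U \<and> closed (K - U)"
    if "p \<in> F" "q \<in> F" "p \<noteq> q" for p q
  proof -
    have "\<not> connected_component_of (top_of_set K) p q"
    proof
      assume "connected_component_of (top_of_set K) p q"
      then obtain T where "connectedin (top_of_set K) T" "p \<in> T" "q \<in> T"
        by (auto simp: connected_component_of_def)
      then have "connected_component K p q"
        by (auto simp: connected_component_def connectedin_subtopology)
      then show False using that sep by blast
    qed
    moreover have "quasi_component_of (top_of_set K) p = connected_component_of (top_of_set K) p"
      using K by (intro quasi_eq_connected_component_of)
        (auto simp: compact_space_subtopology Hausdorff_space_subtopology)
    ultimately have "\<not> quasi_component_of (top_of_set K) p q" by simp
    then obtain U W where UW: "openin (top_of_set K) U" "openin (top_of_set K) W"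
      "U \<union> W = K" "disjnt U W" "p \<in> U" "q \<in> W"
      using \<open>p \<in> F\<close> \<open>q \<in> F\<close> F(2) by (auto simp: quasi_component_of_alt)
    have "K - U = W" "K - W = U" using UW by (auto simp: disjnt_iff)
    then have "closedin (top_of_set K) U" "closedin (top_of_set K) W"
      using UW by (metis closedin_diff closedin_topspace topspace_euclidean_subtopology)+
    then have "closed U" "closed W"
      using K compact_imp_closed closedin_closed_trans by blast+
    then show ?thesis
      using UW \<open>K - U = W\<close> by (intro exI[of _ U]) auto
  qed
  define C where "C = (\<lambda>p q. SOME U. p \<in> U \<and> q \<notin> U \<and> U \<subseteq> K \<and> closed U \<and> closed (K - U))"
  have C: "p \<in> C p q \<and> q \<notin> C p q \<and> C p q \<subseteq> K \<and> closed (C p q) \<and> closed (K - C p q)"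
    if "p \<in> F" "q \<in> F" "p \<noteq> q" for p q
    unfolding C_def by (rule someI_ex[OF *[OF that]])
  \<comment> \<open>Removing every \<open>C q p\<close> makes the sets disjoint, since
    \<open>A q\<close> lies inside \<open>C q p\<close>.\<close>
  define A where "A = (\<lambda>p. K \<inter> (\<Inter>q\<in>F - {p}. C p q \<inter> (K - C q p)))"
  show thesis
  proof
    fix p assume p: "p \<in> F"
    have "K - A p = (\<Union>q\<in>F - {p}. (K - C p q) \<union> C q p)"
      using C p unfolding A_def by blast
    moreover have "closed (\<Union>q\<in>F - {p}. (K - C p q) \<union> C q p)"
      using F C p by (intro closed_UN closed_Un) auto
    moreover have "closed (A p)"
      unfolding A_def using K C p
      by (intro closed_Int closed_INT) (auto simp: compact_imp_closed)
    ultimately show "p \<in> A p \<and> A p \<subseteq> K \<and> closed (A p) \<and> closed (K - A p)"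
      using C p F unfolding A_def by auto
  next
    fix p q assume "p \<in> F" "q \<in> F" "p \<noteq> q"
    then show "A p \<inter> A q = {}" unfolding A_def by blast
  qed
qed

lemma compact_positive_scale:
  fixes f :: "'a::topological_space \<Rightarrow> real"
  assumes "compact W" "continuous_on W f" "\<And>x. x \<in> W \<Longrightarrow> f x > 0"
  obtains T where "T > 0" "\<And>x. x \<in> W \<Longrightarrow> M < T * f x"
proof (cases "W = {}")
  case True
  then show thesis using that[of 1] by simp
next
  case False
  then obtain w where w: "w \<in> W" "\<And>x. x \<in> W \<Longrightarrow> f w \<le> f x"
    using continuous_attains_inf[OF assms(1) _ assms(2)] by blast
  define T where "T = (\<bar>M\<bar> + 1) / f w"
  have "T > 0" using assms(3)[OF w(1)] by (simp add: T_def)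
  moreover have "M < T * f x" if "x \<in> W" for x
  proof -
    have "M < T * f w" using assms(3)[OF w(1)] by (simp add: T_def)
    also have "\<dots> \<le> T * f x" using \<open>T > 0\<close> w(2)[OF that] by simp
    finally show ?thesis .
  qed
  ultimately show thesis using that by blast
qed

section \<open>Components of zero sets of nonnegative polynomials\<close>

text \<open>A copy of R^I in one fixed space, so that coordinates are added and dropped without
  reindexing.\<close>

definition coord_space :: "nat set \<Rightarrow> (nat \<Rightarrow> real) set" where
  "coord_space I = {x. \<forall>i. i \<notin> I \<longrightarrow> x i = 0}"

text \<open>Tychonoff's theorem, with the factor {0} at every index outside
  \<open>I\<close>.\<close>

lemma compact_coord_box: "compact {x \<in> coord_space I. \<forall>i\<in>I. \<bar>x i\<bar> \<le> r}"
proof -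
  define B where "B = (\<lambda>i::nat. if i \<in> I then {-r..r} else {0::real})"
  have "compactin (product_topology (\<lambda>i. euclidean) UNIV) (PiE UNIV B)"
    unfolding compactin_PiE by (auto simp: B_def)
  moreover have "PiE UNIV B = {x \<in> coord_space I. \<forall>i\<in>I. \<bar>x i\<bar> \<le> r}"
    by (auto simp: B_def coord_space_def PiE_def Pi_def abs_le_iff minus_le_iff split: if_splits)
  ultimately show ?thesis
    by (simp add: euclidean_product_topology)
qed

text \<open>For large \<open>T\<close> the function \<open>T P + \<Sum> x\<^sub>i^(d+2)\<close> has a local minimum near every component of
  the zero set of \<open>P\<close>, and at a critical point \<open>x\<^sub>i^(d+1)\<close> is a polynomial of degree at most \<open>d\<close>.\<close>

theorem components_le_zero_set:
  assumes I: "finite I" and P: "poly_fun I d P" and nonneg: "\<And>x. 0 \<le> P x" and "even d"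
  shows "components_le {x \<in> coord_space I. P x = 0} (Suc d ^ card I)"
proof (rule components_leI)
  let ?Z = "{x \<in> coord_space I. P x = 0}"
  fix F assume F: "finite F" "F \<subseteq> ?Z"
    and sep: "\<And>p q. p \<in> F \<Longrightarrow> q \<in> F \<Longrightarrow> connected_component ?Z p q \<Longrightarrow> p = q"
  show "card F \<le> Suc d ^ card I"
  \<comment> \<open>With a single point \<open>K - A p\<close> could be empty;
    \<open>infdist\<close> to the empty set is 0, and the function \<phi> below would lose its
    positivity on \<open>A p\<close>.\<close>
  proof (cases "card F \<le> 1")
    case True
    then show ?thesis by (metis One_nat_def Suc_le_eq order_trans zero_less_Suc zero_less_power)
  next
    case False
    \<comment> \<open>\<open>d + 2\<close> is the least even exponent above \<open>d\<close>: even,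
      so that \<open>g\<close> is nonnegative with bounded sublevel sets in
      \<open>coord_space I\<close>; above \<open>d\<close>, so that its derivative dominates those
      of \<open>P\<close>.\<close>
    define g where "g = (\<lambda>x::nat \<Rightarrow> real. \<Sum>i\<in>I. x i ^ Suc (Suc d))"
    have even: "even (Suc (Suc d))" using \<open>even d\<close> by simp
    have cont_g: "continuous_on A g" for A
      unfolding g_def
      by (intro continuous_intros continuous_on_subset[OF continuous_on_product_coordinates]) auto
    have g_ge: "x i ^ Suc (Suc d) \<le> g x" if "i \<in> I" for x i
      unfolding g_def using I that even
      by (intro member_le_sum) (auto simp: zero_le_even_power simp del: power_Suc)
    \<comment> \<open>A level above the values of \<open>g\<close> on \<open>F\<close>, where the
      perturbed function agrees with \<open>g\<close>; \<open>T\<close> will push that function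
      above \<open>M\<close> on a barrier around each point.\<close>
    define M where "M = Max (g ` F) + 1"
    have M: "g p < M" if "p \<in> F" for p
      unfolding M_def using F that by (metis Max_ge add_strict_increasing2 finite_imageI image_eqI
        less_add_one order_le_less_trans)
    have "M > 0"
    proof -
      obtain p where "p \<in> F" using False by fastforce
      moreover have "0 \<le> g p" unfolding g_def using even
        by (intro sum_nonneg) (auto simp: zero_le_even_power simp del: power_Suc)
      ultimately show ?thesis using M by fastforce
    qed
    define B where "B = {x \<in> coord_space I. g x \<le> M}"
    have "\<bar>x i\<bar> \<le> max 1 M" if "x \<in> B" "i \<in> I" for x i
    proof (rule ccontr)
      assume "\<not> ?thesis"
      then have *: "1 \<le> \<bar>x i\<bar>" "M < \<bar>x i\<bar>" by auto
      have "\<bar>x i\<bar> \<le> \<bar>x i\<bar> ^ Suc (Suc d)"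
        using * by (intro self_le_power) auto
      also have "\<dots> = x i ^ Suc (Suc d)" using even by (simp add: power_even_abs del: power_Suc)
      also have "\<dots> \<le> M" using g_ge[OF that(2), of x] that(1) by (auto simp: B_def)
      finally show False using * by simp
    qed
    then have "B = {x \<in> coord_space I. \<forall>i\<in>I. \<bar>x i\<bar> \<le> max 1 M} \<inter> {x. g x \<le> M}"
      by (auto simp: B_def)
    moreover have "closed {x. g x \<le> M}"
      by (intro closed_Collect_le cont_g continuous_on_const)
    ultimately have "compact B"
      using compact_Int_closed[OF compact_coord_box] by presburger
    \<comment> \<open>The zero set may be unbounded; this compact piece contains \<open>F\<close>,
      and points separated in the zero set remain separated in it.\<close>
    define K where "K = B \<inter> {x. P x = 0}"
    have "compact K"
      unfolding K_def using \<open>compact B\<close> closed_Collect_eq[OF continuous_on_poly_fun[OF P] continuous_on_const]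
      by (intro compact_Int_closed) auto
    have "F \<subseteq> K" using F M by (auto simp: K_def B_def less_imp_le)
    have "K \<subseteq> ?Z" by (auto simp: K_def B_def)
    obtain A where A: "\<And>p. p \<in> F \<Longrightarrow> p \<in> A p \<and> A p \<subseteq> K \<and> closed (A p) \<and> closed (K - A p)"
      and disj: "\<And>p q. p \<in> F \<Longrightarrow> q \<in> F \<Longrightarrow> p \<noteq> q \<Longrightarrow> A p \<inter> A q = {}"
      using compact_clopen_separation[OF \<open>compact K\<close> F(1) \<open>F \<subseteq> K\<close>]
        connected_component_of_subset[OF _ \<open>K \<subseteq> ?Z\<close>] sep by (smt (verit))
    have ne: "K - A p \<noteq> {}" if "p \<in> F" for p
    proof -
      have "\<not> F \<subseteq> {p}" using False F card_mono[of "{p}" F] by auto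
      then obtain q where "q \<in> F" "q \<noteq> p" by auto
      then show ?thesis using disj[of p q] A[of q] that by blast
    qed
    \<comment> \<open>A signed distance: positive on \<open>A p\<close>, negative on the rest of
      \<open>K\<close>. Its positivity sets for different \<open>p\<close> are disjoint open
      neighbourhoods of the sets \<open>A p\<close>.\<close>
    define \<phi> where "\<phi> = (\<lambda>p x. infdist x (K - A p) - infdist x (A p))"
    have cont_\<phi>: "continuous_on UNIV (\<phi> p)" for p
      unfolding \<phi>_def by (intro continuous_intros)
    have \<phi>_pos: "\<phi> p x > 0" if "p \<in> F" "x \<in> A p" for p x
      using that A[OF that(1)] ne[OF that(1)] in_closed_iff_infdist_zero[of "K - A p" x]
        infdist_nonneg[of x "K - A p"]
      by (auto simp: \<phi>_def less_le)
    have \<phi>_neg: "\<phi> p x < 0" if "p \<in> F" "x \<in> K - A p" for p x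
      using that A[OF that(1)] in_closed_iff_infdist_zero[of "A p" x]
        infdist_nonneg[of x "A p"]
      by (auto simp: \<phi>_def less_le)
    have \<phi>_disj: "p = q" if "p \<in> F" "q \<in> F" "\<phi> p x > 0" "\<phi> q x > 0" for p q x
    proof (rule ccontr)
      assume "p \<noteq> q"
      then have "A q \<subseteq> K - A p" "A p \<subseteq> K - A q" "A p \<noteq> {}" "A q \<noteq> {}"
        using disj[of p q] A that by blast+
      then have "infdist x (K - A p) \<le> infdist x (A q)" "infdist x (K - A q) \<le> infdist x (A p)"
        by (auto intro: infdist_mono)
      then show False using that by (auto simp: \<phi>_def)
    qed
    \<comment> \<open>The barrier between these neighbourhoods. It avoids the zeros of
      \<open>P\<close>, so by compactness one \<open>T\<close> lifts \<open>T * P\<close> above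
      \<open>M\<close> on all of it.\<close>
    define W where "W = (\<Union>p\<in>F. B \<inter> {x. \<phi> p x = 0})"
    have "compact W"
      unfolding W_def using F \<open>compact B\<close> closed_Collect_eq[OF cont_\<phi> continuous_on_const]
      by (intro compact_UN compact_Int_closed) auto
    moreover have "P x > 0" if "x \<in> W" for x
    proof (rule ccontr)
      assume "\<not> ?thesis"
      then have "P x = 0" using nonneg[of x] by simp
      with that obtain p where "p \<in> F" "x \<in> K" "\<phi> p x = 0"
        by (auto simp: W_def K_def)
      then show False using \<phi>_pos[of p x] \<phi>_neg[of p x] by force
    qed
    ultimately obtain T where T: "T > 0" "\<And>x. x \<in> W \<Longrightarrow> M < T * P x"
      using compact_positive_scale[of W P M] continuous_on_poly_fun[OF P] by blast
    define f where "f = (\<lambda>x. T * P x + g x)"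
    have cont_f: "continuous_on S f" for S
      unfolding f_def by (intro continuous_intros cont_g continuous_on_poly_fun[OF P])
    have "\<exists>x \<in> coord_space I. \<phi> p x > 0 \<and> g x < M \<and>
        (\<forall>y \<in> coord_space I. \<phi> p y > 0 \<longrightarrow> g y < M \<longrightarrow> f x \<le> f y)" if p: "p \<in> F" for p
    proof -
      \<comment> \<open>A minimum over this compact set is at most \<open>f p < M\<close>, which
        excludes both \<open>g x = M\<close> and the barrier. It therefore lies in the relatively
        open part, where it is a local minimum.\<close>
      let ?N = "B \<inter> {x. \<phi> p x \<ge> 0}"
      have "compact ?N"
        using \<open>compact B\<close> closed_Collect_le[OF continuous_on_const cont_\<phi>]
        by (intro compact_Int_closed) auto
      moreover have pN: "p \<in> ?N" using A[OF p] \<phi>_pos[of p p] p by (auto simp: K_def)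
      ultimately obtain x where x: "x \<in> ?N" "\<And>y. y \<in> ?N \<Longrightarrow> f x \<le> f y"
        using continuous_attains_inf[OF _ _ cont_f, of ?N] by blast
      have "f x \<le> f p" using x pN by blast
      also have "f p = g p" using F p by (auto simp: f_def)
      finally have fx: "f x < M" using M[OF p] by simp
      have "0 \<le> T * P x" "0 \<le> g x"
        unfolding g_def using T nonneg even
        by (auto intro!: sum_nonneg simp: zero_le_even_power simp del: power_Suc)
      then have "g x < M" "T * P x < M" using fx by (auto simp: f_def)
      moreover have "\<phi> p x \<noteq> 0" using \<open>T * P x < M\<close> T(2)[of x] x(1) p by (auto simp: W_def)
      ultimately show ?thesis
        using x by (intro bexI[of _ x]) (auto simp: B_def)
    qed
    then obtain c where c: "\<And>p. p \<in> F \<Longrightarrow> c p \<in> coord_space I \<and> \<phi> p (c p) > 0 \<and> g (c p) < M \<and>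
        (\<forall>y \<in> coord_space I. \<phi> p y > 0 \<longrightarrow> g y < M \<longrightarrow> f (c p) \<le> f y)"
      by metis
    obtain P' where P': "\<And>i. poly_fun I d (P' i)"
      "\<And>i x. ((\<lambda>s. P (x(i := s))) has_field_derivative P' i x) (at (x i))"
      using poly_fun_partial_derivative[OF P] by metis
    \<comment> \<open>Restricting to the coordinate line through \<open>c p\<close> reduces the
      critical point equation to one-variable calculus.\<close>
    have crit: "c p i ^ Suc d = - T / real (Suc (Suc d)) * P' i (c p)" if p: "p \<in> F" and i: "i \<in> I" for p i
    proof -
      let ?x = "c p"
      let ?u = "\<lambda>s. ?x(i := s)"
      have cont_u: "continuous_on UNIV ?u"
      proof (rule continuous_on_coordinatewise_then_product)
        show "continuous_on UNIV (\<lambda>s. ?u s j)" for j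
          by (cases "j = i") (auto intro: continuous_intros)
      qed
      define O' where "O' = {s. \<phi> p (?u s) > 0} \<inter> {s. g (?u s) < M}"
      have "open O'"
        unfolding O'_def
        by (intro open_Int open_Collect_less continuous_on_const
            continuous_on_compose2[OF cont_\<phi> cont_u] continuous_on_compose2[OF cont_g cont_u]) auto
      moreover have "?x i \<in> O'" using c[OF p] by (simp add: O'_def)
      ultimately have "\<exists>e>0. \<forall>s. dist s (?x i) < e \<longrightarrow> s \<in> O'"
        by (rule open_dist[THEN iffD1, THEN bspec])
      then obtain e where e: "e > 0" "\<forall>s. dist s (?x i) < e \<longrightarrow> s \<in> O'"
        by (elim exE conjE)
      have "((\<lambda>s. \<Sum>j\<in>I. (?u s) j ^ Suc (Suc d)) has_field_derivative
          (\<Sum>j\<in>I. if j = i then real (Suc (Suc d)) * ?x i ^ Suc d else 0)) (at (?x i))"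
      proof (rule DERIV_sum)
        fix j
        show "((\<lambda>s. (?u s) j ^ Suc (Suc d)) has_field_derivative
          (if j = i then real (Suc (Suc d)) * ?x i ^ Suc d else 0)) (at (?x i))"
          using DERIV_pow[of "Suc (Suc d)" "?x i"] by (cases "j = i") simp_all
      qed
      then have "((\<lambda>s. f (?u s)) has_field_derivative
          T * P' i ?x + real (Suc (Suc d)) * ?x i ^ Suc d) (at (?x i))"
        unfolding f_def g_def using I i
        by (intro DERIV_add DERIV_cmult P'(2)) (simp_all del: fun_upd_apply of_nat_Suc power_Suc)
      moreover have "\<forall>s. \<bar>?x i - s\<bar> < e \<longrightarrow> f (?u (?x i)) \<le> f (?u s)"
      proof (intro allI impI)
        fix s assume "\<bar>?x i - s\<bar> < e"
        then have "s \<in> O'" using e(2) by (simp add: dist_real_def abs_minus_commute)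
        moreover have "?u s \<in> coord_space I" using c[OF p] i by (auto simp: coord_space_def)
        ultimately show "f (?u (?x i)) \<le> f (?u s)"
          using c[OF p] by (auto simp: O'_def)
      qed
      ultimately have "T * P' i ?x + real (Suc (Suc d)) * ?x i ^ Suc d = 0"
        using DERIV_local_min e(1) by blast
      then have "real (Suc (Suc d)) * ?x i ^ Suc d = - T * P' i ?x" by simp
      then show ?thesis by (simp add: field_simps del: power_Suc of_nat_Suc)
    qed
    have "inj_on c F"
      using c \<phi>_disj by (intro inj_onI) metis
    then have "card F = card (c ` F)" by (simp add: card_image)
    also have "\<dots> \<le> Suc d ^ card I"
    proof (rule card_le_if_powers_reduce[OF I])
      show "poly_fun I d (\<lambda>x. - T / real (Suc (Suc d)) * P' i x)" for i
        by (intro poly_fun_cmult P')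
      show "x i ^ Suc d = - T / real (Suc (Suc d)) * P' i x" if "x \<in> c ` F" "i \<in> I" for x i
        using that crit by blast
    qed (use F c in \<open>auto simp: coord_space_def\<close>)
    finally show ?thesis .
  qed
qed

section \<open>From computation trees to polynomial equations\<close>

fun operand_inputs :: "operand \<Rightarrow> nat set" where
  "operand_inputs (OInput i) = {i}"
| "operand_inputs _ = {}"

lemma finite_operand_inputs [simp]: "finite (operand_inputs a)"
  by (cases a) auto

lemma card_operand_inputs_le: "card (operand_inputs a) \<le> 1"
  by (cases a) auto

lemma operand_inputs_subset: "operand_wf N d a \<Longrightarrow> operand_inputs a \<subseteq> {..<N}"
  by (cases a) auto

text \<open>\<open>es\<close> is the symbolic form of the list of stored values, as functions of the
  coordinates. Degree at most 1 is the invariant kept along a path.\<close>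

lemma poly_fun_operand_val:
  assumes "operand_wf N (length es) a" "\<And>e. e \<in> set es \<Longrightarrow> poly_fun I 1 e"
  shows "poly_fun (I \<union> operand_inputs a) 1 (\<lambda>u. operand_val a u (map (\<lambda>e. e u) es))"
  using assms by (cases a) (auto intro: poly_fun.const poly_fun_var poly_fun_mono)

lemma poly_fun_apply_op:
  assumes "poly_fun I 1 f" "poly_fun I 1 g"
  shows "poly_fun I 2 (\<lambda>u. apply_op op (f u) (g u))"
proof (cases op)
  case OpPlus
  then show ?thesis using poly_fun_mono[OF poly_fun.add[OF assms], of I 2] by simp
next
  case OpMinus
  then show ?thesis using poly_fun_mono[OF poly_fun_diff[OF assms], of I 2] by simp
next
  case OpTimes
  then show ?thesis using poly_fun_mult[OF assms] by (simp add: numeral_2_eq_2)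
qed

lemma poly_fun_power2: "poly_fun I d f \<Longrightarrow> poly_fun I (2 * d) (\<lambda>x. (f x)\<^sup>2)"
  using poly_fun_mult[of I d f d f] by (simp add: power2_eq_square mult_2)

lemma operand_val_cong:
  "operand_wf N d a \<Longrightarrow> (\<And>i. i < N \<Longrightarrow> x i = y i) \<Longrightarrow> operand_val a x ys = operand_val a y ys"
  by (cases a) auto

lemma act_run_cong:
  assumes "act_wf N d t" "\<And>i. i < N \<Longrightarrow> x i = y i"
  shows "act_run t x ys = act_run t y ys"
  using assms(1)
proof (induction t arbitrary: d ys)
  case (Comp f a b t)
  then have "operand_val a x ys = operand_val a y ys" "operand_val b x ys = operand_val b y ys"
    using operand_val_cong[OF _ assms(2)] by auto
  with Comp show ?case by auto
next
  case (Branch a t0 tp tn)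
  then have "operand_val a x ys = operand_val a y ys"
    using operand_val_cong[OF _ assms(2)] by auto
  with Branch show ?case by (auto simp: Let_def)
qed auto

lemma poly_fun_upd: "poly_fun I d f \<Longrightarrow> j \<notin> I \<Longrightarrow> f (x(j := s)) = f x"
  by (erule poly_fun_cong) auto

lemma map_poly_fun_upd:
  assumes "\<And>e. e \<in> set es \<Longrightarrow> poly_fun I d e" "j \<notin> I"
  shows "map (\<lambda>e. e (x(j := s))) es = map (\<lambda>e. e x) es"
  using assms poly_fun_upd[of I d _ j x s] by simp

lemma act_run_upd: "act_wf N d t \<Longrightarrow> N \<le> j \<Longrightarrow> act_run t (x(j := s)) ys = act_run t x ys"
  by (erule act_run_cong) auto

text \<open>Scaling the coordinates outside \<open>I\<close> linearly to 0 leaves \<open>Q\<close>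
  unchanged and deforms the cylinder onto its base. This removes \<open>N\<close> from the
  exponent.\<close>

lemma components_le_cylinder:
  assumes "components_le {x \<in> coord_space I. Q x} k" "I \<subseteq> J"
    and Q: "\<And>x y. (\<And>i. i \<in> I \<Longrightarrow> x i = y i) \<Longrightarrow> Q x = Q y"
  shows "components_le {x \<in> coord_space J. Q x} k"
proof (rule components_le_deformation[OF assms(1)])
  show "{x \<in> coord_space I. Q x} \<subseteq> {x \<in> coord_space J. Q x}"
    using \<open>I \<subseteq> J\<close> by (auto simp: coord_space_def)
  fix x assume x: "x \<in> {x \<in> coord_space J. Q x}"
  define \<gamma> where "\<gamma> = (\<lambda>s i. if i \<in> I then x i else s * x i :: real)"
  have \<gamma>: "\<gamma> s \<in> coord_space J" "Q (\<gamma> s)" for s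
    using x Q[of x "\<gamma> s"] by (auto simp: \<gamma>_def coord_space_def)
  have "\<gamma> 0 \<in> coord_space I" by (auto simp: \<gamma>_def coord_space_def)
  have "continuous_on {0..1} \<gamma>"
  proof (rule continuous_on_coordinatewise_then_product)
    show "continuous_on {0..1} (\<lambda>s. \<gamma> s i)" for i
      by (cases "i \<in> I") (auto simp: \<gamma>_def intro: continuous_intros)
  qed
  then have "connected (\<gamma> ` {0..1})" by (intro connected_continuous_image) auto
  moreover have "\<gamma> 1 = x" by (auto simp: \<gamma>_def)
  then have "x \<in> \<gamma> ` {0..1}" by (metis atLeastAtMost_iff image_eqI order_refl zero_le_one)
  ultimately have "connected_component {x \<in> coord_space J. Q x} x (\<gamma> 0)"
    unfolding connected_component_def using \<gamma> by (intro exI[of _ "\<gamma> ` {0..1}"]) auto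
  then show "\<gamma> 0 \<in> {x \<in> coord_space I. Q x} \<and> connected_component {x \<in> coord_space J. Q x} x (\<gamma> 0)"
    using \<gamma> \<open>\<gamma> 0 \<in> coord_space I\<close> by auto
qed

text \<open>An existential quantifier over coordinate \<open>j\<close> is a projection, and a
  continuous image has no more components than its source. Forgetting \<open>j\<close> is realised
  by setting it to 0.\<close>

lemma components_le_project:
  assumes "components_le {x \<in> coord_space (insert j J). R x} k" "j \<notin> J"
    and "\<And>x. x \<in> coord_space J \<Longrightarrow> Q x \<longleftrightarrow> (\<exists>s. R (x(j := s)))"
  shows "components_le {x \<in> coord_space J. Q x} k"
proof -
  have "{x \<in> coord_space J. Q x} = (\<lambda>x. x(j := 0)) ` {x \<in> coord_space (insert j J). R x}"
  proof (intro equalityI subsetI)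
    fix x assume x: "x \<in> {x \<in> coord_space J. Q x}"
    then obtain s where "R (x(j := s))" using assms(3) by auto
    moreover have "x(j := s) \<in> coord_space (insert j J)" using x by (auto simp: coord_space_def)
    moreover have "x = (x(j := s))(j := 0)" using x assms(2) by (auto simp: coord_space_def)
    ultimately show "x \<in> (\<lambda>x. x(j := 0)) ` {x \<in> coord_space (insert j J). R x}" by blast
  next
    fix y assume "y \<in> (\<lambda>x. x(j := 0)) ` {x \<in> coord_space (insert j J). R x}"
    then obtain x where x: "x \<in> coord_space (insert j J)" "R x" "y = x(j := 0)" by auto
    then have "y \<in> coord_space J" by (auto simp: coord_space_def)
    moreover have "R (y(j := x j))" using x by simp
    ultimately show "y \<in> {x \<in> coord_space J. Q x}" using assms(3) by blast
  qed
  moreover have "continuous_on A (\<lambda>x. x(j := 0 :: real))" for A :: "(nat \<Rightarrow> real) set"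
  proof (rule continuous_on_coordinatewise_then_product)
    show "continuous_on A (\<lambda>x. (x(j := 0)) i)" for i
      by (cases "i = j")
        (auto intro: continuous_on_subset[OF continuous_on_product_coordinates])
  qed
  ultimately show ?thesis using components_le_image[OF assms(1)] by metis
qed

text \<open>Every vertex adds one equation, at most two input coordinates and one fresh coordinate
  \<open>N + length es\<close>, which holds the value computed there or a witness \<open>s\<close> of \<open>v > 0\<close> via
  \<open>v s\<^sup>2 = 1\<close>. The bound depends only on the coordinates in \<open>I\<close>, not on \<open>N\<close>.\<close>

lemma components_le_act_run:
  assumes "act_wf N (length es) t" "finite I" "I \<subseteq> {..<N + length es}"
    and "\<And>e. e \<in> set es \<Longrightarrow> poly_fun I 1 e" "poly_fun I 6 P" "\<And>u. 0 \<le> P u"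
  shows "components_le {u \<in> coord_space ({..<N} \<union> I). P u = 0 \<and> act_run t u (map (\<lambda>e. e u) es)}
    (3 ^ act_height t * 7 ^ (card I + 3 * act_height t))"
  using assms
proof (induction t arbitrary: es I P)
  case (Leaf b)
  show ?case
  proof (cases b)
    case False
    then show ?thesis by (simp add: components_le_empty)
  next
    case True
    have "components_le {u \<in> coord_space I. P u = 0} (Suc 6 ^ card I)"
      by (rule components_le_zero_set[OF Leaf.prems(2,5,6)]) simp
    then have "components_le {u \<in> coord_space ({..<N} \<union> I). P u = 0} (Suc 6 ^ card I)"
    proof (rule components_le_cylinder[where Q = "\<lambda>u. P u = 0"])
      fix x y :: "nat \<Rightarrow> real"
      assume "\<And>i. i \<in> I \<Longrightarrow> x i = y i"
      from poly_fun_cong[OF Leaf.prems(5) this] show "(P x = 0) = (P y = 0)" by simp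
    qed simp
    with True show ?thesis by simp
  qed
next
  case (Comp f a b t)
  define v where "v = (\<lambda>u. apply_op f (operand_val a u (map (\<lambda>e. e u) es))
    (operand_val b u (map (\<lambda>e. e u) es)))"
  \<comment> \<open>This index lies beyond the inputs and all of \<open>I\<close>; as
    \<open>es\<close> grows at every vertex, it is new each time.\<close>
  define j where "j = N + length es"
  define I' where "I' = insert j (I \<union> (operand_inputs a \<union> operand_inputs b))"
  have sub: "operand_inputs a \<union> operand_inputs b \<subseteq> {..<N}"
    using Comp.prems(1) operand_inputs_subset[of N "length es"] by (simp only: act_wf.simps Un_least)
  have "j \<notin> {..<N} \<union> I" using Comp.prems(3) by (auto simp: j_def)
  have J: "{..<N} \<union> I' = insert j ({..<N} \<union> I)" using sub by (auto simp: I'_def)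
  have v: "poly_fun (I \<union> (operand_inputs a \<union> operand_inputs b)) 2 v"
    unfolding v_def
  proof (rule poly_fun_apply_op)
    show "poly_fun (I \<union> (operand_inputs a \<union> operand_inputs b)) 1 (\<lambda>u. operand_val a u (map (\<lambda>e. e u) es))"
      by (rule poly_fun_mono[OF poly_fun_operand_val[where es = es and I = I]]) (use Comp.prems in auto)
    show "poly_fun (I \<union> (operand_inputs a \<union> operand_inputs b)) 1 (\<lambda>u. operand_val b u (map (\<lambda>e. e u) es))"
      by (rule poly_fun_mono[OF poly_fun_operand_val[where es = es and I = I]]) (use Comp.prems in auto)
  qed
  \<comment> \<open>Since \<open>P\<close> is nonnegative, adding a square conjoins an equation and
    keeps one nonnegative polynomial. Degrees are not added: the square has degree 4, within the
    allowed 6.\<close>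
  define P' where "P' = (\<lambda>u. P u + (u j - v u)\<^sup>2)"
  define es' where "es' = es @ [\<lambda>u. u j]"
  have "poly_fun I' 4 (\<lambda>u. (u j - v u)\<^sup>2)"
    using poly_fun_power2[of I' 2 "\<lambda>u. u j - v u"]
      poly_fun_diff[of I' 2 "\<lambda>u. u j" v] poly_fun_mono[OF v, of I' 2]
      poly_fun_mono[OF poly_fun_var[of j I'], of I' 2]
    by (auto simp: I'_def)
  then have "poly_fun I' 6 P'"
    unfolding P'_def using poly_fun_mono[OF Comp.prems(5), of I' 6]
    by (intro poly_fun.add) (auto simp: I'_def intro: poly_fun_mono)
  then have IH: "components_le {u \<in> coord_space ({..<N} \<union> I'). P' u = 0 \<and> act_run t u (map (\<lambda>e. e u) es')}
    (3 ^ act_height t * 7 ^ (card I' + 3 * act_height t))"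
  proof (intro Comp.IH[where es = es' and I = I' and P = P'])
    show "I' \<subseteq> {..<N + length es'}"
      using Comp.prems(3) sub by (auto simp: I'_def es'_def j_def)
    show "poly_fun I' 1 e" if "e \<in> set es'" for e
      using that poly_fun_mono[OF Comp.prems(4), of e I' 1] poly_fun_var[of j I']
      by (auto simp: es'_def I'_def)
  qed (use Comp.prems in \<open>auto simp: es'_def I'_def P'_def\<close>)
  have "components_le {u \<in> coord_space ({..<N} \<union> I). P u = 0 \<and>
      act_run (Comp f a b t) u (map (\<lambda>e. e u) es)} (3 ^ act_height t * 7 ^ (card I' + 3 * act_height t))"
  proof (rule components_le_project[OF IH[unfolded J] \<open>j \<notin> {..<N} \<union> I\<close>,
        where Q = "\<lambda>u. P u = 0 \<and> act_run (Comp f a b t) u (map (\<lambda>e. e u) es)"])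
    fix u
    have upd: "P (u(j := s)) = P u" "v (u(j := s)) = v u"
      "map (\<lambda>e. e (u(j := s))) es = map (\<lambda>e. e u) es"
      "act_run t (u(j := s)) ys = act_run t u ys" for s ys
      using \<open>j \<notin> {..<N} \<union> I\<close> sub Comp.prems(1)
      by (auto intro!: poly_fun_upd[OF Comp.prems(5)] poly_fun_upd[OF v]
          map_poly_fun_upd[OF Comp.prems(4)] act_run_upd simp: j_def simp del: map_eq_conv)
    have "P' (u(j := s)) = 0 \<longleftrightarrow> P u = 0 \<and> s = v u" for s
      using Comp.prems(6)[of u] by (simp add: P'_def upd add_nonneg_eq_0_iff)
    moreover have "act_run (Comp f a b t) u (map (\<lambda>e. e u) es) = act_run t u (map (\<lambda>e. e u) es @ [v u])"
      by (simp add: v_def)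
    moreover have "map (\<lambda>e. e (u(j := s))) es' = map (\<lambda>e. e u) es @ [s]" for s
      unfolding es'_def by (simp only: map_append upd list.map fun_upd_same)
    ultimately show "(P u = 0 \<and> act_run (Comp f a b t) u (map (\<lambda>e. e u) es)) \<longleftrightarrow>
      (\<exists>s. P' (u(j := s)) = 0 \<and> act_run t (u(j := s)) (map (\<lambda>e. e (u(j := s))) es'))"
      by (simp only: upd) blast
  qed
  moreover have "card I' \<le> card I + 3"
    using card_operand_inputs_le[of a] card_operand_inputs_le[of b]
      card_Un_le[of I "operand_inputs a \<union> operand_inputs b"]
      card_Un_le[of "operand_inputs a" "operand_inputs b"]
    unfolding I'_def by (simp add: card_insert_if Comp.prems(2))
  then have "(3::nat) ^ act_height t * 7 ^ (card I' + 3 * act_height t) \<le>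
    3 ^ act_height (Comp f a b t) * 7 ^ (card I + 3 * act_height (Comp f a b t))"
    by (intro mult_le_mono power_increasing) auto
  ultimately show ?case
    by (rule components_le_mono)
next
  case (Branch a t0 tp tn)
  define v where "v = (\<lambda>u. operand_val a u (map (\<lambda>e. e u) es))"
  define j where "j = N + length es"
  define I0 where "I0 = I \<union> operand_inputs a"
  define h where "h = max (act_height t0) (max (act_height tp) (act_height tn))"
  \<comment> \<open>A common bound for the three outcomes. The remaining factor 3 of the claim pays
    for their union, and \<open>3 * Suc h\<close> leaves room for the operand and a witness.\<close>
  define K where "K = (3::nat) ^ h * 7 ^ (card I + 3 * Suc h)"
  have sub: "operand_inputs a \<subseteq> {..<N}"
    using Branch.prems(1) operand_inputs_subset[of N "length es"] by (simp only: act_wf.simps)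
  have "j \<notin> {..<N} \<union> I" using Branch.prems(3) by (auto simp: j_def)
  have v: "poly_fun I0 1 v"
    unfolding v_def I0_def using Branch.prems by (intro poly_fun_operand_val) auto
  have P0: "poly_fun I0 6 P"
    using poly_fun_mono[OF Branch.prems(5)] by (auto simp: I0_def)
  \<comment> \<open>A branching vertex stores a copy of its operand, already of degree at most 1, so
    the value itself needs no coordinate; only a strict sign introduces one.\<close>
  define es' where "es' = es @ [v]"
  have es': "poly_fun I0 1 e" if "e \<in> set es'" for e
    using that v poly_fun_mono[OF Branch.prems(4), of e I0 1] by (auto simp: es'_def I0_def)
  have I0: "finite I0" "I0 \<subseteq> {..<N + length es}" "{..<N} \<union> I0 = {..<N} \<union> I"
    using Branch.prems(2,3) sub by (auto simp: I0_def)
  have cardI0: "card I0 \<le> card I + 1"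
    using card_operand_inputs_le[of a] card_Un_le[of I "operand_inputs a"] by (simp add: I0_def)
  have K_ge: "3 ^ k * 7 ^ (c + 3 * k) \<le> K" if "k \<le> h" "c \<le> card I + 2" for k c
    unfolding K_def using that by (intro mult_le_mono power_increasing) auto
  have zero: "components_le {u \<in> coord_space ({..<N} \<union> I). P u = 0 \<and> v u = 0 \<and>
      act_run t0 u (map (\<lambda>e. e u) es')} K"
  proof -
    define P' where "P' = (\<lambda>u. P u + (v u)\<^sup>2)"
    have "poly_fun I0 6 P'"
      unfolding P'_def using poly_fun_mono[OF poly_fun_power2[OF v], of I0 6]
      by (intro poly_fun.add P0) auto
    then have "components_le {u \<in> coord_space ({..<N} \<union> I0). P' u = 0 \<and> act_run t0 u (map (\<lambda>e. e u) es')}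
      (3 ^ act_height t0 * 7 ^ (card I0 + 3 * act_height t0))"
      by (intro Branch.IH(1)[where es = es' and I = I0 and P = P'])
        (use Branch.prems I0 es' in \<open>auto simp: es'_def P'_def\<close>)
    moreover have "P' u = 0 \<longleftrightarrow> P u = 0 \<and> v u = 0" for u
      using Branch.prems(6) by (simp add: P'_def add_nonneg_eq_0_iff)
    ultimately have "components_le {u \<in> coord_space ({..<N} \<union> I). P u = 0 \<and> v u = 0 \<and>
      act_run t0 u (map (\<lambda>e. e u) es')} (3 ^ act_height t0 * 7 ^ (card I0 + 3 * act_height t0))"
      by (simp add: I0 conj_assoc)
    then show ?thesis
      by (rule components_le_mono) (use cardI0 in \<open>auto simp: h_def intro!: K_ge\<close>)
  qed
  have sign: "components_le {u \<in> coord_space ({..<N} \<union> I). P u = 0 \<and> \<sigma> * v u > 0 \<and>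
      act_run t u (map (\<lambda>e. e u) es')} K"
    if t: "act_wf N (Suc (length es)) t" "act_height t \<le> h"
      and IH: "\<And>es I P. act_wf N (length es) t \<Longrightarrow> finite I \<Longrightarrow> I \<subseteq> {..<N + length es} \<Longrightarrow>
        (\<And>e. e \<in> set es \<Longrightarrow> poly_fun I 1 e) \<Longrightarrow> poly_fun I 6 P \<Longrightarrow> (\<And>u. 0 \<le> P u) \<Longrightarrow>
        components_le {u \<in> coord_space ({..<N} \<union> I). P u = 0 \<and> act_run t u (map (\<lambda>e. e u) es)}
          (3 ^ act_height t * 7 ^ (card I + 3 * act_height t))" for t and \<sigma> :: real
  proof -
    define I' where "I' = insert j I0"
    have J: "{..<N} \<union> I' = insert j ({..<N} \<union> I)" using I0 by (auto simp: I'_def)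
    \<comment> \<open>The strict inequality becomes an equation with a witness, the inverse square
      root of \<open>\<sigma> * v u\<close>; \<sigma> is 1 or -1 for the two signs. The inner
      expression has degree 3 and its square 6, which fixes the degree used throughout.\<close>
    define P' where "P' = (\<lambda>u. P u + (u j * (u j * (\<sigma> * v u)) - 1)\<^sup>2)"
    have "poly_fun I' 3 (\<lambda>u. u j * (u j * (\<sigma> * v u)))"
      unfolding numeral_3_eq_3
      by (intro poly_fun.var_times poly_fun_cmult poly_fun_mono[OF v]) (auto simp: I'_def)
    then have "poly_fun I' (2 * 3) (\<lambda>u. (u j * (u j * (\<sigma> * v u)) - 1)\<^sup>2)"
      by (intro poly_fun_power2 poly_fun_diff poly_fun.const)
    then have "poly_fun I' 6 P'"
      unfolding P'_def using poly_fun_mono[OF P0, of I' 6]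
      by (intro poly_fun.add) (auto simp: I'_def)
    then have IH': "components_le {u \<in> coord_space ({..<N} \<union> I'). P' u = 0 \<and> act_run t u (map (\<lambda>e. e u) es')}
      (3 ^ act_height t * 7 ^ (card I' + 3 * act_height t))"
    proof (intro IH[where es = es' and I = I' and P = P'])
      show "poly_fun I' 1 e" if "e \<in> set es'" for e
        using poly_fun_mono[OF es'[OF that], of I' 1] by (auto simp: I'_def)
    qed (use Branch.prems t I0 in \<open>auto simp: es'_def I'_def P'_def j_def\<close>)
    have "components_le {u \<in> coord_space ({..<N} \<union> I). P u = 0 \<and> \<sigma> * v u > 0 \<and>
      act_run t u (map (\<lambda>e. e u) es')} (3 ^ act_height t * 7 ^ (card I' + 3 * act_height t))"
    proof (rule components_le_project[OF IH'[unfolded J] \<open>j \<notin> {..<N} \<union> I\<close>,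
          where Q = "\<lambda>u. P u = 0 \<and> \<sigma> * v u > 0 \<and> act_run t u (map (\<lambda>e. e u) es')"])
      fix u
      have "j \<notin> I0" using \<open>j \<notin> {..<N} \<union> I\<close> I0(3) by blast
      then have upd: "P (u(j := s)) = P u" "v (u(j := s)) = v u"
        "map (\<lambda>e. e (u(j := s))) es' = map (\<lambda>e. e u) es'"
        "act_run t (u(j := s)) ys = act_run t u ys" for s ys
        using t(1)
        by (auto intro!: poly_fun_upd[OF P0] poly_fun_upd[OF v]
            map_poly_fun_upd[OF es'] act_run_upd simp: j_def simp del: map_eq_conv)
      have "P' (u(j := s)) = 0 \<longleftrightarrow> P u = 0 \<and> s * (s * (\<sigma> * v u)) = 1" for s
        using Branch.prems(6)[of u] by (simp add: P'_def upd add_nonneg_eq_0_iff)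
      moreover have "0 < w \<longleftrightarrow> (\<exists>s. s * (s * w) = 1)" for w :: real
      proof
        assume "0 < w"
        then have "inverse (sqrt w) * (inverse (sqrt w) * w) = 1"
          by (simp add: field_simps)
        then show "\<exists>s. s * (s * w) = 1" by blast
      next
        assume "\<exists>s. s * (s * w) = 1"
        then obtain s where s: "s * s * w = 1" by (auto simp: mult.assoc)
        show "0 < w"
        proof (rule ccontr)
          assume "\<not> 0 < w"
          then have "s * s * w \<le> 0" by (intro mult_nonneg_nonpos) auto
          with s show False by simp
        qed
      qed
      ultimately show "(P u = 0 \<and> \<sigma> * v u > 0 \<and> act_run t u (map (\<lambda>e. e u) es')) \<longleftrightarrow>
        (\<exists>s. P' (u(j := s)) = 0 \<and> act_run t (u(j := s)) (map (\<lambda>e. e (u(j := s))) es'))"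
        by (simp only: upd) blast
    qed
    moreover have "card I' \<le> card I + 2"
      using cardI0 I0(1) by (simp add: I'_def card_insert_if)
    ultimately show ?thesis
      using t(2) by (blast intro: components_le_mono K_ge)
  qed
  have pos: "components_le {u \<in> coord_space ({..<N} \<union> I). P u = 0 \<and> 1 * v u > 0 \<and>
      act_run tp u (map (\<lambda>e. e u) es')} K"
    by (rule sign[OF _ _ Branch.IH(2)]) (use Branch.prems(1) in \<open>auto simp: h_def\<close>)
  have neg: "components_le {u \<in> coord_space ({..<N} \<union> I). P u = 0 \<and> - 1 * v u > 0 \<and>
      act_run tn u (map (\<lambda>e. e u) es')} K"
    by (rule sign[OF _ _ Branch.IH(3)]) (use Branch.prems(1) in \<open>auto simp: h_def\<close>)
  have run: "act_run (Branch a t0 tp tn) u (map (\<lambda>e. e u) es) \<longleftrightarrow>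
      v u = 0 \<and> act_run t0 u (map (\<lambda>e. e u) es') \<or>
      1 * v u > 0 \<and> act_run tp u (map (\<lambda>e. e u) es') \<or>
      - 1 * v u > 0 \<and> act_run tn u (map (\<lambda>e. e u) es')" for u
  proof -
    have "map (\<lambda>e. e u) es' = map (\<lambda>e. e u) es @ [v u]" by (simp add: es'_def)
    moreover have "operand_val a u (map (\<lambda>e. e u) es) = v u" by (simp add: v_def)
    ultimately show ?thesis
      by (cases "v u" "0 :: real" rule: linorder_cases) (simp_all add: Let_def)
  qed
  have "{u \<in> coord_space ({..<N} \<union> I). P u = 0 \<and> act_run (Branch a t0 tp tn) u (map (\<lambda>e. e u) es)}
    = {u \<in> coord_space ({..<N} \<union> I). P u = 0 \<and> v u = 0 \<and> act_run t0 u (map (\<lambda>e. e u) es')} \<union>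
      ({u \<in> coord_space ({..<N} \<union> I). P u = 0 \<and> 1 * v u > 0 \<and> act_run tp u (map (\<lambda>e. e u) es')} \<union>
       {u \<in> coord_space ({..<N} \<union> I). P u = 0 \<and> - 1 * v u > 0 \<and> act_run tn u (map (\<lambda>e. e u) es')})"
    using run by blast
  moreover have "3 ^ act_height (Branch a t0 tp tn) * 7 ^ (card I + 3 * act_height (Branch a t0 tp tn))
    = K + (K + K)"
    by (simp add: K_def h_def)
  ultimately show ?case
    using components_le_Un[OF zero components_le_Un[OF pos neg]] by simp
qed

section \<open>The height bound\<close>

text \<open>The induction starts with no stored values, no coordinates in \<open>I\<close> and the
  polynomial 0, so the bound is \<open>3^h * 7^(3h)\<close>.\<close>

lemma b0_le_height:
  assumes "tests_membership N t S"
  shows "b0 S \<le> 1029 ^ act_height t"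
proof -
  have "RN N = coord_space {..<N}"
    by (simp add: RN_def coord_space_def not_less)
  then have "S = {u \<in> coord_space {..<N}. act_run t u []}"
    using assms unfolding tests_membership_def by blast
  then have "components_le S (3 ^ act_height t * 7 ^ (3 * act_height t))"
    using assms components_le_act_run[of N "[]" t "{}" "\<lambda>_. 0"]
    by (simp add: tests_membership_def poly_fun.const)
  then have "b0 S \<le> 3 ^ act_height t * 7 ^ (3 * act_height t)"
    by (rule b0_le)
  also have "\<dots> = 1029 ^ act_height t"
    by (simp add: power_mult flip: power_mult_distrib)
  finally show ?thesis .
qed

theorem mainTheorem8:
  shows "\<exists>c1 c2 :: real. c1 > 0 \<and> c2 > 0 \<and>
    (\<forall>(N::nat) (S :: (nat \<Rightarrow> real) set) (V :: (nat \<Rightarrow> complex) set) (t :: act).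
       semialg N S \<and> real_alg_set N V \<and> union_of_nonsingular_real_varieties N V \<and>
       S \<subseteq> real_points N V \<and> tests_membership N t S \<longrightarrow>
       (c1 * ln (real (b0 S)) - c2 * real (alg_dim N V)) / (1 + ln (real (alg_deg N V)))
         \<le> real (act_height t))"
proof (intro exI conjI)
  \<comment> \<open>The first constant is the one that turns \<open>b0 S <= 1029^h\<close> into a
    lower bound for \<open>h\<close> after taking logarithms.\<close>
  show "0 < 1 / ln (1029 :: real)" "0 < (1 :: real)" by simp_all
  show "\<forall>(N::nat) (S :: (nat \<Rightarrow> real) set) (V :: (nat \<Rightarrow> complex) set) (t :: act).
       semialg N S \<and> real_alg_set N V \<and> union_of_nonsingular_real_varieties N V \<and>
       S \<subseteq> real_points N V \<and> tests_membership N t S \<longrightarrow>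
       (1 / ln 1029 * ln (real (b0 S)) - 1 * real (alg_dim N V)) / (1 + ln (real (alg_deg N V)))
         \<le> real (act_height t)"
  proof (intro allI impI; elim conjE)
    fix N S V t
    assume "tests_membership N t S"
    then have b0: "b0 S \<le> 1029 ^ act_height t" by (rule b0_le_height)
    define D where "D = 1 + ln (real (alg_deg N V))"
    \<comment> \<open>If the degree evaluates to 0, the convention \<open>ln 0 = 0\<close> still
      gives \<open>D = 1\<close>; the same convention covers \<open>b0 S = 0\<close> below.\<close>
    have "1 \<le> D"
      by (cases "alg_deg N V = 0") (auto simp: D_def)
    have "ln (real (b0 S)) \<le> real (act_height t) * ln 1029"
    proof (cases "b0 S = 0")
      case False
      then have "ln (real (b0 S)) \<le> ln (1029 ^ act_height t)"
        using b0 by (subst ln_le_cancel_iff) (auto simp flip: of_nat_le_iff)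
      then show ?thesis by (simp add: ln_realpow)
    qed simp
    then have "1 / ln 1029 * ln (real (b0 S)) \<le> real (act_height t)"
      by (simp add: divide_le_eq)
    then have "1 / ln 1029 * ln (real (b0 S)) - 1 * real (alg_dim N V) \<le> real (act_height t)"
      by linarith
    also have "\<dots> \<le> real (act_height t) * D"
      using \<open>1 \<le> D\<close> by (simp add: mult_le_cancel_left1)
    finally show "(1 / ln 1029 * ln (real (b0 S)) - 1 * real (alg_dim N V)) / (1 + ln (real (alg_deg N V)))
        \<le> real (act_height t)"
      using \<open>1 \<le> D\<close> unfolding D_def[symmetric] by (simp add: divide_le_eq)
  qed
qed

end
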